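(* Let $\mathcal{X}\subset\mathbb{R}^n$ be a convex set, and let $D:=\max_{x,x'\in\mathcal{X}}\|x-x'\|$. Let $p\ge1$, $\tau\in(0,1]$, and let $F:\mathbb{R}^n\to\mathbb{R}^n$ satisfy $\|\nabla^{p-1}F(x)-\nabla^{p-1}F(y)\|\le L_p\|x-y\|$, with $\mathrm{VI}_{\mathcal{X}}(F(x))\neq\emptyset$. Let $\{x^k\}_{k\ge1}$ and $\{x^{k+0.5}\}_{k\ge1}$ be generated by the ARE iteration $$x^{k+0.5}:=\mathrm{VI}_{\mathcal{X}}\left(\tilde F(x;x^k)+L_p\|x-x^k\|^{p-1}(x-x^k)\right),$$ $$x^{k+1}:=\arg\min_{x\in\mathcal{X}}\ \langle F(x^{k+0.5}),x-x^k\rangle+\frac{L_p\|x^{k+0.5}-x^k\|^{p-1}}{2}\|x-x^k\|^2,\qquad k=1,2,\dots$$ Suppose that $F$ is monotone and that the approximation mapping $\tilde F(\cdot\,;x^k)$ is such that the bound $$\|\tilde F(x;y)-F(x)\|\le\tau L_p\|x-y\|^p$$ holds (with $y=x^k$). Then $$m(\bar x_N):=\max_{x\in\mathcal{X}}\ \langle F(x),\bar x_N-x\rangle\le\frac{D^2}{2\Gamma_N}=\mathcal{O}\left(N^{-\frac{p+1}{2}}\right),$$ where, for $N>0$, $$\bar x_N:=\frac{\sum_{k=1}^N\frac{x^{k+0.5}}{\gamma_k}}{\Gamma_N},\qquad \Gamma_N:=\sum_{k=1}^N\gamma_k^{-1},\qquad \gamma_k:=L_p\|x^{k+0.5}-x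^k\|^{p-1}.$$
   Context: $\|\cdot\|$ is the Euclidean norm (and the corresponding norm for derivative tensors); $\nabla^{p-1}F$ is the $(p-1)$-th derivative of $F$, with $\nabla^0F=F$. For a mapping $T:\mathbb{R}^n\to\mathbb{R}^n$, $\mathrm{VI}_{\mathcal{X}}(T(x)):=\{x^*\in\mathcal{X}\mid\langle T(x^* ),x-x^*\rangle\ge0\ \text{for all }x\in\mathcal{X}\}$. $F$ is monotone if $\langle F(x)-F(y),x-y\rangle\ge0$ for all $x,y\in\mathcal{X}$. For each $y\in\mathcal{X}$, $\tilde F(\cdot\,;y):\mathbb{R}^n\to\mathbb{R}^n$ is an approximation of $F$ at $y$. In the iteration, $x^{k+0.5}$ denotes any element of the stated solution set, where $x$ is the variable and $x^k$ is fixed. ARE stands for Approximation-based Regularized Extra-gradient method.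
   Formalization: The rate O(N^{-(p+1)/2}) is proved only if τ<1 or p=1; for τ=1, p≥2 it fails (X=[-1,1], F=0, F̃(x;y)=-L|x-y|^{p-1}(x-y), x^k=0, x^{k+0.5}=1). The bound D²/(2Γ_N) is proved for all τ in (0,1]. The γ_k are assumed nonzero, so that 1/γ_k is defined. *)

theory Defs
  imports "HOL-Analysis.Analysis" "HOL-Library.Landau_Symbols"
begin

definition VI :: "'a::real_inner set \<Rightarrow> ('a \<Rightarrow> 'a) \<Rightarrow> 'a set" where
  "VI X T = {xs \<in> X. \<forall>x\<in>X. T xs \<bullet> (x - xs) \<ge> 0}"

definition monotone_operator_on :: "'a::real_inner set \<Rightarrow> ('a \<Rightarrow> 'a) \<Rightarrow> bool" where
  "monotone_operator_on X F \<longleftrightarrow> (\<forall>x\<in>X. \<forall>y\<in>X. (F x - F y) \<bullet> (x - y) \<ge> 0)"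

text \<open>Higher derivatives as multilinear forms: for a list \<open>hs\<close> of length \<open>k\<close>,
  \<open>nth_deriv F hs x\<close> is the \<open>k\<close>-th Frechet derivative of \<open>F\<close> at \<open>x\<close> applied to
  the directions in \<open>hs\<close>. The list encoding avoids a codomain type that depends on \<open>k\<close>.\<close>

fun nth_deriv :: "('a::real_normed_vector \<Rightarrow> 'b::real_normed_vector) \<Rightarrow> 'a list \<Rightarrow> 'a \<Rightarrow> 'b" where
  "nth_deriv F [] x = F x"
| "nth_deriv F (h # hs) x = frechet_derivative (nth_deriv F hs) (at x) h"

text \<open>In finite dimensions the tensor-valued map \<open>x \<mapsto> \<nabla>\<^sup>j F x\<close> is differentiable
  iff all its evaluations at fixed directions are.\<close>

definition times_differentiable ::
    "nat \<Rightarrow> ('a::euclidean_space \<Rightarrow> 'b::euclidean_space) \<Rightarrow> bool" where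
  "times_differentiable k F \<longleftrightarrow>
     (\<forall>hs. length hs < k \<longrightarrow> (\<forall>x. nth_deriv F hs differentiable (at x)))"

text \<open>Operator norm of a \<open>k\<close>-linear form; for \<open>k = 0\<close> it is the norm of the value.\<close>

definition tensor_norm :: "nat \<Rightarrow> ('a::real_normed_vector list \<Rightarrow> 'b::real_normed_vector) \<Rightarrow> real" where
  "tensor_norm k T = (SUP hs\<in>{hs. length hs = k \<and> (\<forall>h\<in>set hs. norm h \<le> 1)}. norm (T hs))"

definition lipschitz_nth_deriv_on ::
    "'a::euclidean_space set \<Rightarrow> nat \<Rightarrow> real \<Rightarrow> ('a \<Rightarrow> 'b::euclidean_space) \<Rightarrow> bool" where
  "lipschitz_nth_deriv_on X k L F \<longleftrightarrow>
     times_differentiable k F \<and>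
     (\<forall>x\<in>X. \<forall>y\<in>X. tensor_norm k (\<lambda>hs. nth_deriv F hs x - nth_deriv F hs y) \<le> L * norm (x - y))"

text \<open>In what follows \<open>xh k\<close> stands for the half-step iterate \<open>x\<^sup>k\<^sup>+\<^sup>0\<^sup>.\<^sup>5\<close>, and
  \<open>Ft x y\<close> for the approximation at \<open>y\<close> evaluated at \<open>x\<close>.\<close>

definition ARE_gamma :: "real \<Rightarrow> nat \<Rightarrow> (nat \<Rightarrow> 'a::real_inner) \<Rightarrow> (nat \<Rightarrow> 'a) \<Rightarrow> nat \<Rightarrow> real" where
  "ARE_gamma L p x xh k = L * norm (xh k - x k) ^ (p - 1)"

definition ARE_iteration ::
    "'a::real_inner set \<Rightarrow> ('a \<Rightarrow> 'a) \<Rightarrow> ('a \<Rightarrow> 'a \<Rightarrow> 'a) \<Rightarrow> real \<Rightarrow> nat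
      \<Rightarrow> (nat \<Rightarrow> 'a) \<Rightarrow> (nat \<Rightarrow> 'a) \<Rightarrow> bool" where
  "ARE_iteration X F Ft L p x xh \<longleftrightarrow>
     x 1 \<in> X \<and>
     (\<forall>k\<ge>1.
        xh k \<in> VI X (\<lambda>z. Ft z (x k) + (L * norm (z - x k) ^ (p - 1)) *\<^sub>R (z - x k)) \<and>
        is_arg_min
          (\<lambda>z. F (xh k) \<bullet> (z - x k)
               + L * norm (xh k - x k) ^ (p - 1) / 2 * (norm (z - x k))\<^sup>2)
          (\<lambda>z. z \<in> X) (x (k + 1)))"

definition ARE_Gamma :: "real \<Rightarrow> nat \<Rightarrow> (nat \<Rightarrow> 'a::real_inner) \<Rightarrow> (nat \<Rightarrow> 'a) \<Rightarrow> nat \<Rightarrow> real" where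
  "ARE_Gamma L p x xh N = (\<Sum>k=1..N. inverse (ARE_gamma L p x xh k))"

definition ARE_average :: "real \<Rightarrow> nat \<Rightarrow> (nat \<Rightarrow> 'a::real_inner) \<Rightarrow> (nat \<Rightarrow> 'a) \<Rightarrow> nat \<Rightarrow> 'a" where
  "ARE_average L p x xh N =
     (\<Sum>k=1..N. xh k /\<^sub>R ARE_gamma L p x xh k) /\<^sub>R ARE_Gamma L p x xh N"

text \<open>The merit function \<open>m\<close>, with the maximum over \<open>X\<close> taken as a supremum: \<open>X\<close> is not
  assumed closed, so the maximum need not be attained.\<close>

definition merit :: "'a::real_inner set \<Rightarrow> ('a \<Rightarrow> 'a) \<Rightarrow> 'a \<Rightarrow> real" where
  "merit X F z = (SUP x\<in>X. F x \<bullet> (z - x))"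

end

theory Submission imports Defs begin

text \<open>Adding the variational inequality of the half step (tested at \<open>x (k + 1)\<close>) to the optimality
  condition of the full step gives, for every \<open>z \<in> X\<close>,
  \<open>F (xh k) \<bullet> (xh k - z) / \<gamma> k \<le> (\<parallel>z - x k\<parallel>\<^sup>2 - \<parallel>z - x (k+1)\<parallel>\<^sup>2 - (1 - \<tau>\<^sup>2) \<parallel>xh k - x k\<parallel>\<^sup>2) / 2\<close>.
  Telescoping and monotonicity bound the merit function. Taking for \<open>z\<close> a solution of the variational
  inequality instead makes the left-hand side nonnegative, so the squared step lengths have a sum of
  at most \<open>D\<^sup>2 / (1 - \<tau>\<^sup>2)\<close>; convexity of \<open>t \<mapsto> t powr (-(p - 1) / 2)\<close> turns this into a lower bound
  of order \<open>N powr ((p + 1) / 2)\<close> on \<open>\<Gamma> N\<close>.\<close>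

section \<open>First-order optimality for the full step\<close>

lemma arg_min_proximal_VI:
  fixes X :: "'a::real_inner set"
  assumes X: "convex X"
    and u: "is_arg_min (\<lambda>z. c \<bullet> (z - y) + g / 2 * (norm (z - y))\<^sup>2) (\<lambda>z. z \<in> X) u"
  shows "u \<in> VI X (\<lambda>z. c + g *\<^sub>R (z - y))"
proof -
  have uX: "u \<in> X"
    and min: "\<And>z. z \<in> X \<Longrightarrow> c \<bullet> (u - y) + g / 2 * (norm (u - y))\<^sup>2 \<le> c \<bullet> (z - y) + g / 2 * (norm (z - y))\<^sup>2"
    using u by (auto simp: is_arg_min_linorder)
  have "(c + g *\<^sub>R (u - y)) \<bullet> (w - u) \<ge> 0" if w: "w \<in> X" for w
  proof (rule ccontr)
    define A where "A = (c + g *\<^sub>R (u - y)) \<bullet> (w - u)"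
    define B where "B = g / 2 * (norm (w - u))\<^sup>2"
    assume "\<not> 0 \<le> (c + g *\<^sub>R (u - y)) \<bullet> (w - u)"
    then have A: "A < 0" by (simp add: A_def)
    \<comment> \<open>Along the segment from \<open>u\<close> to \<open>w\<close> the objective
      changes by \<open>t * (A + t * B)\<close>. With this \<open>t\<close> the bound
      \<open>A + t * \<bar>B\<bar>\<close> equals \<open>- A\<^sup>2 / (\<bar>B\<bar> - A)\<close>,
      which is negative. The absolute value covers both signs of \<open>g\<close>.\<close>
    define t where "t = - A / (\<bar>B\<bar> - A)"
    have t: "0 < t" "t \<le> 1" using A by (auto simp: t_def divide_simps)
    define z where "z = u + t *\<^sub>R (w - u)"
    have "z = (1 - t) *\<^sub>R u + t *\<^sub>R w" by (simp add: z_def algebra_simps)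
    then have "z \<in> X" using convexD_alt[OF X uX w] t by simp
    then have "0 \<le> c \<bullet> (z - y) + g / 2 * (norm (z - y))\<^sup>2 - (c \<bullet> (u - y) + g / 2 * (norm (u - y))\<^sup>2)"
      using min by fastforce
    also have "\<dots> = t * (A + t * B)"
    proof -
      have "(norm (z - y))\<^sup>2 = (norm (u - y))\<^sup>2 + 2 * t * ((u - y) \<bullet> (w - u)) + t\<^sup>2 * (norm (w - u))\<^sup>2"
      proof -
        have "(norm (v + t *\<^sub>R d))\<^sup>2 = (norm v)\<^sup>2 + 2 * t * (v \<bullet> d) + t\<^sup>2 * (norm d)\<^sup>2" for v d :: 'a
          unfolding power2_norm_eq_inner
          by (simp add: inner_add_left inner_add_right inner_commute[of d v] power2_eq_square algebra_simps)
        moreover have "z - y = (u - y) + t *\<^sub>R (w - u)" by (simp add: z_def)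
        ultimately show ?thesis by (simp only:)
      qed
      moreover have "c \<bullet> (z - y) = c \<bullet> (u - y) + t * (c \<bullet> (w - u))"
        by (simp add: z_def algebra_simps inner_add_right inner_diff_right)
      moreover have "A = c \<bullet> (w - u) + g * ((u - y) \<bullet> (w - u))"
        by (simp add: A_def inner_add_left)
      ultimately show ?thesis
        by (simp only: B_def) (simp add: power2_eq_square field_simps)
    qed
    finally have "0 \<le> A + t * B" using t by (simp add: zero_le_mult_iff)
    also have "\<dots> \<le> A + t * \<bar>B\<bar>" using t by (simp add: mult_left_mono)
    also have "\<dots> = - A\<^sup>2 / (\<bar>B\<bar> - A)"
    proof -
      have "\<bar>B\<bar> - A \<noteq> 0" using A by linarith
      then show ?thesis by (simp add: t_def field_simps power2_eq_square)
    qed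
    also have "\<dots> < 0" using A by (simp add: divide_less_0_iff)
    finally show False by simp
  qed
  then show ?thesis using uX by (auto simp: VI_def)
qed

section \<open>Energy estimate for one iteration\<close>

lemma inner_diff_three_point:
  fixes a b z :: "'a::real_inner"
  shows "(a - b) \<bullet> (z - a) = ((norm (z - b))\<^sup>2 - (norm (z - a))\<^sup>2 - (norm (a - b))\<^sup>2) / 2"
  by (simp add: power2_norm_eq_inner inner_diff_left inner_diff_right inner_commute)

text \<open>Split \<open>xm - z\<close> at \<open>x1\<close>: the part \<open>x1 - z\<close> is
  controlled by the full step, the part \<open>xm - x1\<close> by the half step plus the
  approximation error. When the three-point identity is applied to both inner products, the squares
  of \<open>x1 - x0\<close> cancel.\<close>

lemma extragradient_step:
  fixes X :: "'a::real_inner set"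
  assumes g: "g \<ge> 0"
    and mid: "xm \<in> VI X (\<lambda>z. G z + g *\<^sub>R (xm - x0))"
    and new: "x1 \<in> VI X (\<lambda>z. F xm + g *\<^sub>R (z - x0))"
    and err: "norm (G xm - F xm) \<le> \<tau> * g * norm (xm - x0)"
    and z: "z \<in> X"
  shows "F xm \<bullet> (xm - z) \<le> g * (((norm (z - x0))\<^sup>2 - (norm (z - x1))\<^sup>2
           - (1 - \<tau>\<^sup>2) * (norm (xm - x0))\<^sup>2) / 2)"
proof -
  define a where "a = norm (xm - x0)"
  define b where "b = norm (x1 - xm)"
  have x1X: "x1 \<in> X" using new by (simp add: VI_def)
  have "0 \<le> (F xm + g *\<^sub>R (x1 - x0)) \<bullet> (z - x1)"
    using new z by (simp add: VI_def)
  then have 1: "F xm \<bullet> (x1 - z) \<le> g * ((x1 - x0) \<bullet> (z - x1))"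
    by (simp add: inner_add_left inner_diff_right[of "F xm"])
  have "0 \<le> (G xm + g *\<^sub>R (xm - x0)) \<bullet> (x1 - xm)"
    using mid x1X by (simp add: VI_def)
  then have 2: "G xm \<bullet> (xm - x1) \<le> g * ((xm - x0) \<bullet> (x1 - xm))"
    by (simp add: inner_add_left inner_diff_right[of "G xm"])
  have "(F xm - G xm) \<bullet> (xm - x1) \<le> norm (F xm - G xm) * norm (xm - x1)"
    by (rule norm_cauchy_schwarz)
  also have "\<dots> \<le> (\<tau> * g * a) * b"
    using err by (simp add: a_def b_def norm_minus_commute mult_right_mono)
  also have "\<dots> = g * (\<tau> * a * b)" by simp
  finally have 3: "(F xm - G xm) \<bullet> (xm - x1) \<le> g * (\<tau> * a * b)" .
  \<comment> \<open>Young's inequality with all of \<tau> placed on \<open>a\<close>: the term in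
    \<open>b\<^sup>2\<close> then cancels exactly against the one from the three-point identity, and
    \<open>1 - \<tau>\<^sup>2\<close> remains as the gain.\<close>
  have "0 \<le> (\<tau> * a - b)\<^sup>2" by simp
  then have 4: "g * (\<tau> * a * b) \<le> g * ((\<tau>\<^sup>2 * a\<^sup>2 + b\<^sup>2) / 2)"
    by (intro mult_left_mono g) (simp add: power2_eq_square algebra_simps)
  have "F xm \<bullet> (xm - z) = (F xm - G xm) \<bullet> (xm - x1) + G xm \<bullet> (xm - x1) + F xm \<bullet> (x1 - z)"
    by (simp add: inner_diff_left inner_diff_right)
  also have "\<dots> \<le> g * ((\<tau>\<^sup>2 * a\<^sup>2 + b\<^sup>2) / 2) + g * ((xm - x0) \<bullet> (x1 - xm)) + g * ((x1 - x0) \<bullet> (z - x1))"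
    using 1 2 3 4 by linarith
  also have "\<dots> = g * ((\<tau>\<^sup>2 * a\<^sup>2 + b\<^sup>2) / 2 + (xm - x0) \<bullet> (x1 - xm) + (x1 - x0) \<bullet> (z - x1))"
    by (simp add: distrib_left)
  also have "(\<tau>\<^sup>2 * a\<^sup>2 + b\<^sup>2) / 2 + (xm - x0) \<bullet> (x1 - xm) + (x1 - x0) \<bullet> (z - x1)
      = ((norm (z - x0))\<^sup>2 - (norm (z - x1))\<^sup>2 - (1 - \<tau>\<^sup>2) * (norm (xm - x0))\<^sup>2) / 2"
    unfolding inner_diff_three_point a_def b_def by (simp add: field_simps)
  finally show ?thesis .
qed

section \<open>Sums of negative powers when the sum of squares is bounded\<close>

text \<open>In the variable u = s^2, the right-hand side is the tangent at u = 1 of the convex map u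
  powr (-n/2).\<close>

lemma inverse_power_ge_tangent:
  fixes s :: real
  assumes "s > 0"
  shows "inverse (s ^ n) \<ge> 1 - real n / 2 * (s\<^sup>2 - 1)"
proof -
  have "ln (s\<^sup>2) \<le> s\<^sup>2 - 1" using assms by (intro ln_le_minus_one) simp
  then have "real n / 2 * (2 * ln s) \<le> real n / 2 * (s\<^sup>2 - 1)"
    using assms by (intro mult_left_mono) (simp_all add: ln_realpow)
  then have "1 - real n / 2 * (s\<^sup>2 - 1) \<le> 1 + (- (real n * ln s))" by simp
  also have "\<dots> \<le> exp (- (real n * ln s))" by (rule exp_ge_add_one_self)
  also have "\<dots> = inverse (s ^ n)" using assms by (simp add: exp_minus exp_of_nat_mult)
  finally show ?thesis .
qed

text \<open>Jensen's inequality by way of tangents: the extreme case is that of equal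
  \<open>a k\<close> whose squares sum to \<open>C\<close>.\<close>

lemma sum_inverse_power_ge:
  fixes a :: "'i \<Rightarrow> real"
  assumes S: "finite S" "S \<noteq> {}"
    and a: "\<And>k. k \<in> S \<Longrightarrow> a k > 0"
    and C: "C > 0" "(\<Sum>k\<in>S. (a k)\<^sup>2) \<le> C"
  shows "(\<Sum>k\<in>S. inverse (a k ^ n)) \<ge> C powr (- real n / 2) * real (card S) powr ((real n + 2) / 2)"
proof -
  define M where "M = real (card S)"
  have M: "M > 0" using S by (simp add: M_def card_gt_0_iff)
  \<comment> \<open>The common value of the \<open>a k\<close> in the extreme case. After division
    by \<open>m\<close> the squares sum to at most \<open>M\<close>, so the linear terms of the
    tangents at 1 contribute a nonnegative amount in total.\<close>
  define m where "m = sqrt (C / M)"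
  have m: "m > 0" "m\<^sup>2 = C / M" using C M by (simp_all add: m_def)
  have "(\<Sum>k\<in>S. (a k)\<^sup>2) / m\<^sup>2 \<le> M"
    using C M m by (simp add: field_simps)
  then have le: "real n / 2 * ((\<Sum>k\<in>S. (a k)\<^sup>2) / m\<^sup>2 - M) \<le> 0"
    by (intro mult_nonneg_nonpos) auto
  have "M \<le> M - real n / 2 * ((\<Sum>k\<in>S. (a k)\<^sup>2) / m\<^sup>2 - M)" using le by simp
  also have "\<dots> = (\<Sum>k\<in>S. 1 - real n / 2 * ((a k / m)\<^sup>2 - 1))"
  proof -
    have "(\<Sum>k\<in>S. (a k / m)\<^sup>2 - 1) = (\<Sum>k\<in>S. (a k)\<^sup>2) / m\<^sup>2 - M"
      by (simp add: sum_subtractf sum_divide_distrib power_divide M_def)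
    moreover have "(\<Sum>k\<in>S. 1 - real n / 2 * ((a k / m)\<^sup>2 - 1))
        = M - real n / 2 * (\<Sum>k\<in>S. (a k / m)\<^sup>2 - 1)"
      by (simp only: sum_subtractf[of "\<lambda>_. 1"] sum_distrib_left M_def sum_constant mult_1_right)
    ultimately show ?thesis by simp
  qed
  also have "\<dots> \<le> (\<Sum>k\<in>S. inverse ((a k / m) ^ n))"
    using a m by (intro sum_mono inverse_power_ge_tangent) simp
  also have "\<dots> = m ^ n * (\<Sum>k\<in>S. inverse (a k ^ n))"
    by (simp add: sum_distrib_left power_divide field_simps)
  finally have "M / m ^ n \<le> (\<Sum>k\<in>S. inverse (a k ^ n))"
    using m by (simp add: field_simps)
  moreover have "m ^ n = C powr (real n / 2) * M powr (- real n / 2)"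
  proof -
    have "m = (C / M) powr (1 / 2)" using C M by (simp add: m_def powr_half_sqrt)
    then have "m ^ n = (C / M) powr (real n / 2)" using m C M by (simp add: powr_power)
    then show ?thesis using C M by (simp add: powr_divide powr_minus_divide)
  qed
  moreover have "M * M powr (real n / 2) = M powr ((real n + 2) / 2)"
    using M powr_add[of M 1 "real n / 2"] by (simp add: add_divide_distrib add.commute)
  ultimately show ?thesis using M C
    by (simp add: M_def[symmetric] powr_minus_divide field_simps)
qed

section \<open>Summation over the iterations\<close>

lemma ARE_weighted_sum_le:
  fixes X :: "'a::real_inner set"
  assumes X: "convex X" and L: "L > 0" and p: "p \<ge> 1"
    and it: "ARE_iteration X F Ft L p x xh"
    and approx: "\<And>k z. k \<ge> 1 \<Longrightarrow> z \<in> X \<Longrightarrow> norm (Ft z (x k) - F z) \<le> \<tau> * L * norm (z - x k) ^ p"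
    and nz: "\<And>k. k \<in> {1..N} \<Longrightarrow> ARE_gamma L p x xh k \<noteq> 0"
    and z: "z \<in> X"
  shows "(\<Sum>k=1..N. inverse (ARE_gamma L p x xh k) * (F (xh k) \<bullet> (xh k - z)))
           + (1 - \<tau>\<^sup>2) / 2 * (\<Sum>k=1..N. (norm (xh k - x k))\<^sup>2) \<le> (norm (z - x 1))\<^sup>2 / 2"
proof -
  let ?g = "ARE_gamma L p x xh"
  have step: "inverse (?g k) * (F (xh k) \<bullet> (xh k - z)) + (1 - \<tau>\<^sup>2) / 2 * (norm (xh k - x k))\<^sup>2
      \<le> (norm (z - x k))\<^sup>2 / 2 - (norm (z - x (Suc k)))\<^sup>2 / 2" if k: "k \<in> {1..N}" for k
  proof -
    have k1: "k \<ge> 1" using k by simp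
    have g: "?g k > 0" using nz[OF k] L by (auto simp: ARE_gamma_def less_le)
    \<comment> \<open>Membership in \<open>VI\<close> evaluates the operator only at the solution
      itself, so the regularization, nonlinear in its argument, may be frozen at
      \<open>xh k\<close>, where its coefficient is exactly \<open>?g k\<close>.\<close>
    have mid: "xh k \<in> VI X (\<lambda>z. Ft z (x k) + ?g k *\<^sub>R (xh k - x k))"
      using it k1 by (simp add: ARE_iteration_def ARE_gamma_def VI_def)
    have new: "x (Suc k) \<in> VI X (\<lambda>z. F (xh k) + ?g k *\<^sub>R (z - x k))"
      using it k1 by (intro arg_min_proximal_VI X) (simp add: ARE_iteration_def ARE_gamma_def)
    have "norm (xh k - x k) ^ p = norm (xh k - x k) ^ (p - 1) * norm (xh k - x k)"
      using p by (simp add: power_eq_if)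
    then have err: "norm (Ft (xh k) (x k) - F (xh k)) \<le> \<tau> * ?g k * norm (xh k - x k)"
      using approx[OF k1, of "xh k"] mid by (simp add: VI_def ARE_gamma_def mult.assoc)
    \<comment> \<open>Dividing by \<open>?g k\<close>, which varies with \<open>k\<close>, leaves
      the squared distances unweighted, so that they telescope.\<close>
    have "inverse (?g k) * (F (xh k) \<bullet> (xh k - z)) \<le> ((norm (z - x k))\<^sup>2 - (norm (z - x (Suc k)))\<^sup>2
           - (1 - \<tau>\<^sup>2) * (norm (xh k - x k))\<^sup>2) / 2"
      using mult_left_mono[OF extragradient_step[where F = F and G = "\<lambda>z. Ft z (x k)",
          OF less_imp_le[OF g] mid new err z], of "inverse (?g k)"] g
      by (simp add: mult.assoc[symmetric])
    then show ?thesis by (simp add: field_simps)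
  qed
  have "(\<Sum>k=1..N. inverse (?g k) * (F (xh k) \<bullet> (xh k - z)))
           + (1 - \<tau>\<^sup>2) / 2 * (\<Sum>k=1..N. (norm (xh k - x k))\<^sup>2)
      = (\<Sum>k=1..N. inverse (?g k) * (F (xh k) \<bullet> (xh k - z)) + (1 - \<tau>\<^sup>2) / 2 * (norm (xh k - x k))\<^sup>2)"
    by (simp add: sum.distrib sum_distrib_left)
  also have "\<dots> \<le> (\<Sum>k=1..N. (norm (z - x k))\<^sup>2 / 2 - (norm (z - x (Suc k)))\<^sup>2 / 2)"
    by (intro sum_mono step)
  also have "\<dots> = (norm (z - x 1))\<^sup>2 / 2 - (norm (z - x (Suc N)))\<^sup>2 / 2"
    by (induction N) auto
  finally show ?thesis by (smt (verit) zero_le_power2 divide_nonneg_pos)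
qed


section \<open>Merit bound and convergence rate\<close>

theorem theorem3p1:
  fixes X :: "(real ^ 'n) set"
    and F :: "real ^ 'n \<Rightarrow> real ^ 'n"
    and Ft :: "real ^ 'n \<Rightarrow> real ^ 'n \<Rightarrow> real ^ 'n"
    and x xh :: "nat \<Rightarrow> real ^ 'n"
    and p :: nat
    and \<tau> L D :: real
  assumes "convex X" and "bounded X" and "D = diameter X"
    and "p \<ge> 1" and "0 < \<tau>" and "\<tau> \<le> 1"
    and "lipschitz_nth_deriv_on X (p - 1) L F"
    and "VI X F \<noteq> {}"
    and "ARE_iteration X F Ft L p x xh"
    and "monotone_operator_on X F"
    and "\<And>k z. k \<ge> 1 \<Longrightarrow> z \<in> X \<Longrightarrow>
           norm (Ft z (x k) - F z) \<le> \<tau> * L * norm (z - x k) ^ p"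
  shows "(\<forall>N>0. (\<forall>k\<in>{1..N}. ARE_gamma L p x xh k \<noteq> 0) \<longrightarrow>
            merit X F (ARE_average L p x xh N) \<le> D\<^sup>2 / (2 * ARE_Gamma L p x xh N)) \<and>
         ((\<forall>k\<ge>1. ARE_gamma L p x xh k \<noteq> 0) \<and> (\<tau> < 1 \<or> p = 1) \<longrightarrow>
            (\<lambda>N. D\<^sup>2 / (2 * ARE_Gamma L p x xh N)) \<in> O(\<lambda>N. real N powr (- (real p + 1) / 2)))"
proof -
  let ?g = "ARE_gamma L p x xh"
  let ?G = "ARE_Gamma L p x xh"
  note X = \<open>convex X\<close> and bX = \<open>bounded X\<close> and D = \<open>D = diameter X\<close> and p = \<open>p \<ge> 1\<close>
    and it = \<open>ARE_iteration X F Ft L p x xh\<close>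
  note approx = assms(11)
  have x1: "x 1 \<in> X" using it by (simp add: ARE_iteration_def)
  have xh: "xh k \<in> X" if "k \<ge> 1" for k
    using it that by (simp add: ARE_iteration_def VI_def)
  have dist_D: "(norm (z - x 1))\<^sup>2 \<le> D\<^sup>2" if "z \<in> X" for z
    using diameter_bounded_bound[OF bX that x1] by (simp add: D dist_norm power_mono)
  \<comment> \<open>Used twice: to pass from \<open>F (xh k)\<close> to \<open>F z\<close> in the
    merit function, and to show that a solution of the variational inequality gives nonnegative
    terms.\<close>
  have mono: "F z \<bullet> (y - z) \<le> F y \<bullet> (y - z)" if "z \<in> X" "y \<in> X" for y z
    using \<open>monotone_operator_on X F\<close> that by (simp add: monotone_operator_on_def inner_diff_left)
  show ?thesis
  proof (cases "L > 0")
    \<comment> \<open>If \<open>L = 0\<close>, every \<open>?g k\<close> vanishes and both claims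
      are vacuous. If \<open>L < 0\<close>, the approximation bound at \<open>x 1\<close> forces
      \<open>X = {x 1}\<close>, so \<open>D = 0\<close>.\<close>
    case False
    have "\<tau> * L * norm (z - x 1) ^ p \<ge> 0" if "z \<in> X" for z
      using approx[of 1 z] that by (meson norm_ge_zero order_trans order_refl)
    then have sing: "X = {x 1}" if "L \<noteq> 0"
    proof -
      have "\<tau> * L < 0" using False that \<open>\<tau> > 0\<close> by (simp add: mult_less_0_iff)
      then have "norm (z - x 1) ^ p \<le> 0" if "z \<in> X" for z
        using \<open>\<And>z. z \<in> X \<Longrightarrow> \<tau> * L * norm (z - x 1) ^ p \<ge> 0\<close>[OF that]
        by (meson mult_neg_pos not_le)
      then have "z = x 1" if "z \<in> X" for z
        using that by (metis norm_le_zero_iff eq_iff_diff_eq_0 not_le zero_less_power)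
      then show ?thesis using x1 by blast
    qed
    have "D = 0" if "L \<noteq> 0" using D sing[OF that] by simp
    moreover have "merit X F (ARE_average L p x xh N) \<le> 0" if "L \<noteq> 0" "N > 0" "\<forall>k\<in>{1..N}. ?g k \<noteq> 0" for N
    proof -
      \<comment> \<open>All weights have the same sign, so \<open>?G N\<close> cannot cancel to zero
        and the average of the constant sequence \<open>x 1\<close> is again
        \<open>x 1\<close>.\<close>
      have "?g k \<le> 0" for k
        using False by (simp add: ARE_gamma_def mult_nonpos_nonneg)
      then have "?g k < 0" if "k \<in> {1..N}" for k
        using that \<open>\<forall>k\<in>{1..N}. ?g k \<noteq> 0\<close> by (simp only: less_le) blast
      then have "0 < (\<Sum>k=1..N. - inverse (?g k))" using \<open>N > 0\<close>
        by (intro sum_pos) auto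
      then have G: "?G N \<noteq> 0" by (simp add: ARE_Gamma_def sum_negf)
      have "xh k = x 1" if "k \<in> {1..N}" for k using xh[of k] sing[OF \<open>L \<noteq> 0\<close>] that by auto
      then have "(\<Sum>k=1..N. xh k /\<^sub>R ?g k) = ?G N *\<^sub>R x 1"
        by (simp add: ARE_Gamma_def scaleR_sum_left)
      then have "ARE_average L p x xh N = x 1" using G by (simp add: ARE_average_def)
      then have "(SUP y\<in>{x 1}. F y \<bullet> (ARE_average L p x xh N - y)) = 0" by simp
      then show ?thesis using sing[OF \<open>L \<noteq> 0\<close>] by (simp add: merit_def)
    qed
    moreover have "L \<noteq> 0" if "?g k \<noteq> 0" for k using that by (auto simp: ARE_gamma_def)
    ultimately show ?thesis by (fastforce simp: Suc_le_eq)
  next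
    case L: True
    have gpos: "?g k > 0" if "?g k \<noteq> 0" for k
      using that L by (auto simp: ARE_gamma_def less_le)
    have main: "(\<Sum>k=1..N. inverse (?g k) * (F (xh k) \<bullet> (xh k - z)))
        + (1 - \<tau>\<^sup>2) / 2 * (\<Sum>k=1..N. (norm (xh k - x k))\<^sup>2) \<le> D\<^sup>2 / 2"
      if "z \<in> X" "\<And>k. k \<in> {1..N} \<Longrightarrow> ?g k \<noteq> 0" for z N
      using ARE_weighted_sum_le[where Ft = Ft and N = N, OF X L p it approx that(2,1)] dist_D[OF that(1)]
      by linarith
    have tau2: "\<tau>\<^sup>2 \<le> 1" using \<open>0 < \<tau>\<close> \<open>\<tau> \<le> 1\<close> by (simp add: power_le_one)
    have merit: "merit X F (ARE_average L p x xh N) \<le> D\<^sup>2 / (2 * ?G N)"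
      if N: "N > 0" and nz: "\<forall>k\<in>{1..N}. ?g k \<noteq> 0" for N
    proof -
      have G: "?G N > 0"
        unfolding ARE_Gamma_def using N nz gpos by (intro sum_pos) auto
      have "F z \<bullet> (ARE_average L p x xh N - z) \<le> D\<^sup>2 / (2 * ?G N)" if z: "z \<in> X" for z
      proof -
        have "?G N *\<^sub>R (ARE_average L p x xh N - z) = (\<Sum>k=1..N. inverse (?g k) *\<^sub>R (xh k - z))"
          using G by (simp add: ARE_average_def scaleR_diff_right sum_subtractf
              scaleR_sum_left[symmetric]) (simp add: ARE_Gamma_def)
        then have "?G N * (F z \<bullet> (ARE_average L p x xh N - z))
            = (\<Sum>k=1..N. inverse (?g k) * (F z \<bullet> (xh k - z)))"
          by (metis (no_types, lifting) inner_scaleR_right inner_sum_right sum.cong)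
        also have "\<dots> \<le> (\<Sum>k=1..N. inverse (?g k) * (F (xh k) \<bullet> (xh k - z)))"
          using z xh nz gpos by (intro sum_mono mult_left_mono mono) (auto simp: less_imp_le)
        also have "\<dots> \<le> D\<^sup>2 / 2 - (1 - \<tau>\<^sup>2) / 2 * (\<Sum>k=1..N. (norm (xh k - x k))\<^sup>2)"
          using main[OF z, of N] nz by simp
        also have "\<dots> \<le> D\<^sup>2 / 2"
          using tau2 by (simp add: sum_nonneg)
        finally show ?thesis using G by (simp add: field_simps)
      qed
      then show ?thesis unfolding merit_def using x1 by (intro cSUP_least) auto
    qed
    have rate: "(\<lambda>N. D\<^sup>2 / (2 * ?G N)) \<in> O(\<lambda>N. real N powr (- (real p + 1) / 2))"
      if nz: "\<forall>k\<ge>1. ?g k \<noteq> 0" and tp: "\<tau> < 1 \<or> p = 1"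
    \<comment> \<open>For \<open>D = 0\<close> the bounded function is identically zero; otherwise
      the constant \<open>C\<close> below is positive.\<close>
    proof (cases "D = 0")
      case False
      have "\<exists>c>0. \<forall>N>0. ?G N \<ge> c * real N powr ((real p + 1) / 2)"
      \<comment> \<open>For \<open>p = 1\<close> the exponent \<open>p - 1\<close> is 0, so every
        \<open>?g k\<close> equals \<open>L\<close> and \<open>?G N\<close> is N / L. For larger
        \<open>p\<close> the step lengths must be controlled, which uses the gain
        \<open>1 - \<tau>\<^sup>2 > 0\<close>.\<close>
      proof (cases "p = 1")
        case True
        then have "?G N = inverse L * real N powr ((real p + 1) / 2)" if "N > 0" for N
          using that by (simp add: ARE_Gamma_def ARE_gamma_def)
        then show ?thesis using L by (intro exI[of _ "inverse L"]) auto
      next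
        case p1: False
        then have "\<tau> < 1" using tp by simp
        then have t1: "1 - \<tau>\<^sup>2 > 0" using \<open>0 < \<tau>\<close> by (simp add: power_less_one_iff abs_square_less_1)
        obtain xs where xs: "xs \<in> VI X F" using \<open>VI X F \<noteq> {}\<close> by blast
        define C where "C = D\<^sup>2 / (1 - \<tau>\<^sup>2)"
        have C: "C > 0" using t1 \<open>D \<noteq> 0\<close> by (simp add: C_def)
        have apos: "norm (xh k - x k) > 0" if "k \<ge> 1" for k
          using nz p p1 that by (auto simp: ARE_gamma_def)
        have sumC: "(\<Sum>k=1..N. (norm (xh k - x k))\<^sup>2) \<le> C" for N
        proof -
          have xsX: "xs \<in> X" using xs by (simp add: VI_def)
          \<comment> \<open>Minty's argument: monotonicity replaces \<open>F xs\<close> by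
            \<open>F (xh k)\<close> in the inequality that defines \<open>xs\<close>.\<close>
          have "0 \<le> F (xh k) \<bullet> (xh k - xs)" if "k \<ge> 1" for k
            using mono[OF xsX xh[OF that]] xs xh[OF that] by (force simp: VI_def)
          then have "0 \<le> (\<Sum>k=1..N. inverse (?g k) * (F (xh k) \<bullet> (xh k - xs)))"
            using nz gpos by (intro sum_nonneg mult_nonneg_nonneg) (auto simp: less_imp_le)
          then have "(1 - \<tau>\<^sup>2) / 2 * (\<Sum>k=1..N. (norm (xh k - x k))\<^sup>2) \<le> D\<^sup>2 / 2"
            using main[OF xsX, of N] nz by simp
          then show ?thesis using t1 by (simp add: C_def field_simps)
        qed
        define c where "c = inverse L * C powr (- real (p - 1) / 2)"
        have "?G N \<ge> c * real N powr ((real p + 1) / 2)" if "N > 0" for N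
        proof -
          \<comment> \<open>The sum bound is applied with \<open>n = p - 1\<close>.\<close>
          have e: "(real p + 1) / 2 = (real (p - 1) + 2) / 2" using p by (simp add: of_nat_diff)
          have "?G N = inverse L * (\<Sum>k=1..N. inverse (norm (xh k - x k) ^ (p - 1)))"
            by (simp add: ARE_Gamma_def ARE_gamma_def sum_distrib_left)
          moreover have "C powr (- real (p - 1) / 2) * real (card {1..N}) powr ((real p + 1) / 2)
              \<le> (\<Sum>k=1..N. inverse (norm (xh k - x k) ^ (p - 1)))"
            unfolding e using that apos C sumC by (intro sum_inverse_power_ge) auto
          ultimately show ?thesis using L
            by (simp add: c_def mult.assoc mult_left_mono)
        qed
        moreover have "c > 0" using L C by (simp add: c_def)
        ultimately show ?thesis by blast
      qed
      then obtain c where c: "c > 0" and cG: "\<And>N. N > 0 \<Longrightarrow> ?G N \<ge> c * real N powr ((real p + 1) / 2)"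
        by blast
      have "norm (D\<^sup>2 / (2 * ?G N)) \<le> D\<^sup>2 / (2 * c) * norm (real N powr (- (real p + 1) / 2))" if "N > 0" for N
      proof -
        let ?w = "real N powr ((real p + 1) / 2)"
        have w: "?w > 0" using that by simp
        have le: "2 * (c * ?w) \<le> 2 * ?G N" using cG[OF that] by simp
        have "2 * (c * ?w) > 0" using c w by simp
        then have "D\<^sup>2 / (2 * ?G N) \<le> D\<^sup>2 / (2 * (c * ?w))" "?G N > 0"
          using le by (auto intro!: divide_left_mono mult_pos_pos simp del: zero_less_mult_iff)
        moreover have "real N powr (- (real p + 1) / 2) = inverse ?w"
          by (metis minus_divide_left powr_minus)
        ultimately show ?thesis by (simp add: field_simps)
      qed
      then show ?thesis
        by (intro bigoI[of _ "D\<^sup>2 / (2 * c)"] eventually_mono[OF eventually_gt_at_top[of 0]]) auto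
    qed simp
    show ?thesis using merit rate by blast
  qed
qed

end
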